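(* Let $f:\mathbb{R}^m\to\mathbb{R}^m$ be Lipschitz continuous and continuously differentiable. Let $\mathcal{C}$ be a nonempty, convex and compact subset of $\mathbb{R}^m$ that is invariant under $f$. Assume that there exist $p\in\mathbb{N}$, $p\ge1$, and a norm $\|\cdot\|$ on $\mathbb{R}^m$ such that the $p$-iteration system $x_{k+p}=f^{(p)}(x_k)$ is sup-mean contractive in $\mathcal{C}$, i.e. $\bar R_{\|\cdot\|}=r_{\|\cdot\|}[f^{(p)}]<0$. Then $x_{k+1}=f(x_k)$ has a unique globally asymptotically stable fixed point in $\mathcal{C}$.
   Context: $f^{(p)}=f\circ\cdots\circ f$ ($p$ factors). Invariance of $\mathcal{C}$ under $f$ means $f(\mathcal{C})\subseteq\mathcal{C}$. The reactivity of a map $g$ on $\mathcal{C}$ with respect to $\|\cdot\|$ is $r_{\|\cdot\|}[g]=L_{\|\cdot\|}[g]-1$, where $L_{\|\cdot\|}[g]=\sup_{x\neq y,\ x,y\in\mathcal{C}}\frac{\|g(x)-g(y)\|}{\|x-y\|}$ (a supremum over the empty set being $0$). For time-invariant maps the sup-mean reactivity $\bar R_{\|\cdot\|}$ equals the reactivity of the map. Global asymptotic stability in $\mathcal{C}$ is for the dynamics restricted to $\mathcal{C}$: the fixed point is Lyapunov stable with respect to initial conditions in $\mathcal{C}$, and every orbit of $x_{k+1}=f(x_k)$ starting in $\mathcal{C}$ converges to it. *)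

theory Defs
  imports "HOL-Analysis.Analysis"
begin

definition is_norm :: "('a::real_vector \<Rightarrow> real) \<Rightarrow> bool" where
  "is_norm N \<longleftrightarrow>
     (\<forall>x. N x = 0 \<longleftrightarrow> x = 0) \<and>
     (\<forall>c x. N (c *\<^sub>R x) = \<bar>c\<bar> * N x) \<and>
     (\<forall>x y. N (x + y) \<le> N x + N y)"

definition continuously_differentiable ::
  "('a::real_normed_vector \<Rightarrow> 'b::real_normed_vector) \<Rightarrow> bool" where
  "continuously_differentiable f \<longleftrightarrow>
     (\<exists>f' :: 'a \<Rightarrow> 'a \<Rightarrow>\<^sub>L 'b.
        (\<forall>x. (f has_derivative blinfun_apply (f' x)) (at x)) \<and> continuous_on UNIV f')"

text \<open>The supremum is taken in \<^typ>\<open>ereal\<close>, so an unbounded set of quotients gives \<open>\<infinity>\<close>.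
  The quotients are nonnegative, so inserting \<open>0\<close> only sets the supremum over the empty set
  to \<open>0\<close> (in \<^typ>\<open>ereal\<close> it would be \<open>-\<infinity>\<close>).\<close>

definition lipschitz_constant ::
  "('a::real_vector \<Rightarrow> real) \<Rightarrow> 'a set \<Rightarrow> ('a \<Rightarrow> 'a) \<Rightarrow> ereal" where
  "lipschitz_constant N C g =
     Sup (insert 0 {ereal (N (g x - g y) / N (x - y)) | x y. x \<in> C \<and> y \<in> C \<and> x \<noteq> y})"

definition reactivity ::
  "('a::real_vector \<Rightarrow> real) \<Rightarrow> 'a set \<Rightarrow> ('a \<Rightarrow> 'a) \<Rightarrow> ereal" where
  "reactivity N C g = lipschitz_constant N C g - 1"

text \<open>For a time-invariant system \<open>x \<mapsto> g x\<close> the sup-mean reactivity is the reactivity of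
  \<open>g\<close>; only time-invariant systems are considered here.\<close>

definition sup_mean_contractive ::
  "('a::real_vector \<Rightarrow> real) \<Rightarrow> 'a set \<Rightarrow> ('a \<Rightarrow> 'a) \<Rightarrow> bool" where
  "sup_mean_contractive N C g \<longleftrightarrow> reactivity N C g < 0"

definition lyapunov_stable_in ::
  "('a::metric_space \<Rightarrow> 'a) \<Rightarrow> 'a set \<Rightarrow> 'a \<Rightarrow> bool" where
  "lyapunov_stable_in f C z \<longleftrightarrow>
     (\<forall>\<epsilon>>0. \<exists>\<delta>>0. \<forall>x\<in>C. dist x z < \<delta> \<longrightarrow> (\<forall>k. dist ((f ^^ k) x) z < \<epsilon>))"

definition globally_asymptotically_stable_in ::
  "('a::metric_space \<Rightarrow> 'a) \<Rightarrow> 'a set \<Rightarrow> 'a \<Rightarrow> bool" where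
  "globally_asymptotically_stable_in f C z \<longleftrightarrow>
     lyapunov_stable_in f C z \<and> (\<forall>x\<in>C. (\<lambda>k. (f ^^ k) x) \<longlonglongrightarrow> z)"

end

theory Submission
  imports Defs
begin

text \<open>All norms on \<open>\<real>\<^sup>m\<close> are equivalent, so although \<open>f\<^sup>p\<close> contracts only in the given norm,
  some power \<open>f\<^sup>s\<close> contracts \<open>\<C>\<close> in the Euclidean distance, and Banach's theorem gives a
  unique fixed point \<open>z\<close> of \<open>f\<^sup>s\<close> in \<open>\<C>\<close>. As \<open>f z\<close> is also fixed by \<open>f\<^sup>s\<close>, \<open>f z = z\<close>.
  Writing \<open>k = s \<cdot> (k div s) + k mod s\<close>, the first part of the iteration contracts geometrically
  while the Lipschitz property bounds the fewer than \<open>s\<close> remaining steps, so that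
  \<open>dist (f\<^sup>k x) z \<le> M c\<^sup>k\<^sup>/\<^sup>s dist x z\<close> with \<open>c < 1\<close> and integer division in the exponent.\<close>

section \<open>Equivalence of an arbitrary norm with the Euclidean norm\<close>

lemma is_norm_zero:
  assumes "is_norm N"
  shows "N 0 = 0"
  using assms unfolding is_norm_def by blast

text \<open>Nonnegativity is not among the axioms in \<open>is_norm\<close>; it follows from
  \<open>0 = N (x + - x) \<le> 2 * N x\<close>.\<close>

lemma is_norm_nonneg:
  assumes "is_norm N"
  shows "0 \<le> N x"
proof -
  have "N (- x) = N x"
    using assms unfolding is_norm_def by (metis abs_minus abs_one mult_1 scaleR_minus1_left)
  moreover have "N (x + - x) \<le> N x + N (- x)" "N 0 = 0"
    using assms unfolding is_norm_def by blast+
  ultimately show ?thesis by simp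
qed

text \<open>Expand \<open>x\<close> in the standard basis: each coordinate is at most
  \<open>norm x\<close> in absolute value, so the sum of the \<open>N b\<close> serves as a
  constant.\<close>

lemma is_norm_upper_bound:
  fixes N :: "'a::euclidean_space \<Rightarrow> real"
  assumes "is_norm N"
  shows "\<exists>B>0. \<forall>x. N x \<le> B * norm x"
proof -
  have sum_le: "N (\<Sum>b\<in>S. g b) \<le> (\<Sum>b\<in>S. N (g b))" if "finite S" for S :: "'a set" and g
    using that
  proof (induction S rule: finite_induct)
    case empty
    then show ?case by (simp add: is_norm_zero[OF assms])
  next
    case (insert b S)
    have "N (g b + (\<Sum>b\<in>S. g b)) \<le> N (g b) + N (\<Sum>b\<in>S. g b)"
      using assms unfolding is_norm_def by blast
    with insert show ?case by simp
  qed
  \<comment> \<open>The extra \<open>1\<close> makes \<open>B\<close> strictly positive from the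
    nonnegativity of the sum alone.\<close>
  define B where "B = (\<Sum>b\<in>Basis. N (b::'a)) + 1"
  have "0 \<le> (\<Sum>b\<in>Basis. N (b::'a))"
    by (simp add: sum_nonneg is_norm_nonneg[OF assms])
  then have "0 < B" by (simp add: B_def)
  have "N x \<le> B * norm x" for x
  proof -
    have "N x = N (\<Sum>b\<in>Basis. (x \<bullet> b) *\<^sub>R b)"
      by (simp add: euclidean_representation)
    also have "\<dots> \<le> (\<Sum>b\<in>Basis. \<bar>x \<bullet> b\<bar> * N b)"
      using sum_le[OF finite_Basis, of "\<lambda>b. (x \<bullet> b) *\<^sub>R b"] assms by (simp add: is_norm_def)
    also have "\<dots> \<le> (\<Sum>b\<in>Basis. norm x * N b)"
      by (intro sum_mono mult_right_mono Basis_le_norm is_norm_nonneg[OF assms])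
    also have "\<dots> \<le> B * norm x"
      by (simp add: B_def sum_distrib_left algebra_simps)
    finally show ?thesis .
  qed
  with \<open>0 < B\<close> show ?thesis by blast
qed

lemma is_norm_continuous:
  fixes N :: "'a::euclidean_space \<Rightarrow> real"
  assumes "is_norm N"
  shows "continuous_on S N"
proof -
  obtain B where B: "B > 0" "\<And>x. N x \<le> B * norm x"
    using is_norm_upper_bound[OF assms] by blast
  have "N x - N y \<le> B * dist x y" for x y
  proof -
    have "N ((x - y) + y) \<le> N (x - y) + N y"
      using assms unfolding is_norm_def by blast
    with B(2)[of "x - y"] show ?thesis by (simp add: dist_norm)
  qed
  then have "B-lipschitz_on S N"
    using B(1) by (auto intro!: lipschitz_onI simp: dist_real_def abs_le_iff) (metis dist_commute)
  then show ?thesis by (rule lipschitz_on_continuous_on)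
qed

text \<open>By compactness \<open>N\<close> attains a minimum on the unit sphere; it is positive,
  and homogeneity carries it to all vectors.\<close>

lemma is_norm_lower_bound:
  fixes N :: "'a::euclidean_space \<Rightarrow> real"
  assumes "is_norm N"
  shows "\<exists>a>0. \<forall>x. a * norm x \<le> N x"
proof -
  have "sphere (0::'a) 1 \<noteq> {}" by simp
  then obtain u where u: "u \<in> sphere 0 1" "\<And>v. v \<in> sphere 0 1 \<Longrightarrow> N u \<le> N v"
    using continuous_attains_inf[OF compact_sphere _ is_norm_continuous[OF assms]] by blast
  from u(1) have "u \<noteq> 0" by auto
  then have "N u \<noteq> 0" using assms by (simp add: is_norm_def)
  then have "0 < N u" using is_norm_nonneg[OF assms, of u] by linarith
  moreover have "N u * norm x \<le> N x" for x
  proof (cases "x = 0")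
    case False
    then have "N u \<le> N ((1 / norm x) *\<^sub>R x)" by (intro u(2)) simp
    also have "\<dots> = N x / norm x"
      using assms by (simp add: is_norm_def)
    finally show ?thesis using False by (simp add: field_simps)
  qed (simp add: is_norm_zero[OF assms])
  ultimately show ?thesis by blast
qed

section \<open>From negative reactivity to a Euclidean contraction\<close>

text \<open>The supremum itself is the factor \<open>q\<close>: the inserted \<open>0\<close> bounds
  it below, and being less than 1 it is a real number.\<close>

lemma sup_mean_contractiveD:
  assumes "is_norm N" and "sup_mean_contractive N C g"
  shows "\<exists>q\<ge>0. q < 1 \<and> (\<forall>x\<in>C. \<forall>y\<in>C. N (g x - g y) \<le> q * N (x - y))"
proof -
  have nonneg: "0 \<le> lipschitz_constant N C g"
    unfolding lipschitz_constant_def by (rule Sup_upper) simp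
  have "lipschitz_constant N C g < 1"
    using assms(2) unfolding sup_mean_contractive_def reactivity_def
    by (cases "lipschitz_constant N C g") (auto simp: one_ereal_def)
  with nonneg obtain q where q: "lipschitz_constant N C g = ereal q" "0 \<le> q" "q < 1"
    by (cases "lipschitz_constant N C g") (auto simp: one_ereal_def)
  have "N (g x - g y) \<le> q * N (x - y)" if "x \<in> C" "y \<in> C" for x y
  proof (cases "x = y")
    case True
    then show ?thesis by (simp add: is_norm_zero[OF assms(1)])
  next
    case False
    have "ereal (N (g x - g y) / N (x - y)) \<le> lipschitz_constant N C g"
      unfolding lipschitz_constant_def using that False by (intro Sup_upper) blast
    moreover have "N (x - y) \<noteq> 0" using assms(1) False by (simp add: is_norm_def)
    then have "N (x - y) > 0" using is_norm_nonneg[OF assms(1), of "x - y"] by linarith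
    ultimately show ?thesis using q(1) by (simp add: field_simps)
  qed
  with q show ?thesis by blast
qed

lemma funpow_in_invariant:
  assumes "f ` C \<subseteq> C" and "x \<in> C"
  shows "(f ^^ k) x \<in> C"
  using assms by (induction k) auto

lemma funpow_norm_contraction:
  fixes N :: "'a::ab_group_add \<Rightarrow> real"
  assumes "g ` C \<subseteq> C" and "0 \<le> q"
    and "\<And>x y. x \<in> C \<Longrightarrow> y \<in> C \<Longrightarrow> N (g x - g y) \<le> q * N (x - y)"
    and "x \<in> C" and "y \<in> C"
  shows "N ((g ^^ n) x - (g ^^ n) y) \<le> q ^ n * N (x - y)"
proof (induction n)
  case (Suc n)
  have "N ((g ^^ Suc n) x - (g ^^ Suc n) y) \<le> q * N ((g ^^ n) x - (g ^^ n) y)"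
    using assms by (simp add: funpow_in_invariant)
  also have "\<dots> \<le> q * (q ^ n * N (x - y))"
    using Suc assms(2) by (rule mult_left_mono)
  finally show ?case by simp
qed simp

lemma lipschitz_on_funpow:
  assumes "f ` C \<subseteq> C" and "L-lipschitz_on C f"
  shows "(L ^ n)-lipschitz_on C (f ^^ n)"
proof (induction n)
  case 0
  show ?case by (auto intro: lipschitz_onI)
next
  case (Suc n)
  have "(f ^^ n) ` C \<subseteq> C" using funpow_in_invariant[OF assms(1)] by blast
  then have "L-lipschitz_on ((f ^^ n) ` C) f"
    by (rule lipschitz_on_subset[OF assms(2)])
  from lipschitz_on_compose[OF Suc this] show ?case by simp
qed

text \<open>Changing from \<open>N\<close> to the Euclidean norm costs the fixed factor
  \<open>B / a\<close>, which a high enough power of \<open>q\<close> absorbs. The value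
  \<open>1/2\<close> stands for any positive constant below 1.\<close>

lemma eventual_contraction:
  fixes g :: "'a::euclidean_space \<Rightarrow> 'a"
  assumes "is_norm N" and "sup_mean_contractive N C g" and "g ` C \<subseteq> C"
  shows "\<exists>n\<ge>1. (1/2)-lipschitz_on C (g ^^ n)"
proof -
  obtain q where q: "0 \<le> q" "q < 1"
      "\<And>x y. x \<in> C \<Longrightarrow> y \<in> C \<Longrightarrow> N (g x - g y) \<le> q * N (x - y)"
    using sup_mean_contractiveD[OF assms(1,2)] by blast
  obtain a where a: "a > 0" "\<And>x. a * norm x \<le> N x"
    using is_norm_lower_bound[OF assms(1)] by blast
  obtain B where B: "B > 0" "\<And>x. N x \<le> B * norm x"
    using is_norm_upper_bound[OF assms(1)] by blast
  obtain n where "q ^ n < a / (2 * B)"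
    using real_arch_pow_inv[of "a / (2 * B)" q] a(1) B(1) q(2) by auto
  \<comment> \<open>The exponent found may be 0, so \<open>Suc n\<close> is used to ensure at least
    one iteration.\<close>
  moreover have "q ^ Suc n \<le> q ^ n"
    using q by (intro power_decreasing) auto
  ultimately have "q ^ Suc n \<le> a / (2 * B)" by linarith
  then have qn: "q ^ Suc n * B \<le> a / 2"
    using B(1) by (simp add: field_simps)
  have "(1/2)-lipschitz_on C (g ^^ Suc n)"
  proof (rule lipschitz_onI)
    fix x y assume xy: "x \<in> C" "y \<in> C"
    have "a * norm ((g ^^ Suc n) x - (g ^^ Suc n) y) \<le> N ((g ^^ Suc n) x - (g ^^ Suc n) y)"
      by (rule a(2))
    also have "\<dots> \<le> q ^ Suc n * N (x - y)"
      using funpow_norm_contraction[where N = N, OF assms(3) q(1) q(3) xy] .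
    also have "\<dots> \<le> q ^ Suc n * (B * norm (x - y))"
      using B(2) q(1) by (intro mult_left_mono) auto
    also have "\<dots> \<le> a / 2 * norm (x - y)"
      using mult_right_mono[OF qn norm_ge_zero[of "x - y"]] by (simp add: mult.assoc)
    finally have "a * dist ((g ^^ Suc n) x) ((g ^^ Suc n) y) \<le> a * (1/2 * dist x y)"
      by (simp add: dist_norm)
    then show "dist ((g ^^ Suc n) x) ((g ^^ Suc n) y) \<le> 1/2 * dist x y"
      using a(1) by (rule mult_left_le_imp_le)
  qed simp
  then show ?thesis by (intro exI[of _ "Suc n"]) simp
qed

section \<open>From an eventual contraction to global asymptotic stability\<close>

text \<open>Boundedness of \<open>b\<close> gives Lyapunov stability, with a radius valid for all
  \<open>k\<close> at once; its convergence to 0 gives attraction.\<close>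

lemma globally_asymptotically_stable_inI:
  fixes b :: "nat \<Rightarrow> real"
  assumes bound: "\<And>x k. x \<in> C \<Longrightarrow> dist ((f ^^ k) x) z \<le> b k * dist x z"
    and b: "b \<longlonglongrightarrow> 0" and M: "\<And>k. b k \<le> M"
  shows "globally_asymptotically_stable_in f C z"
  unfolding globally_asymptotically_stable_in_def lyapunov_stable_in_def
proof (intro conjI allI impI ballI)
  fix \<epsilon> :: real assume "\<epsilon> > 0"
  \<comment> \<open>\<open>M\<close> may be 0 or negative, while the radius
    \<open>\<epsilon> / M'\<close> needs a positive divisor.\<close>
  define M' where "M' = max 1 M"
  have M': "M' > 0" "\<And>k. b k \<le> M'"
    using M unfolding M'_def by (auto intro: max.coboundedI2)
  show "\<exists>\<delta>>0. \<forall>x\<in>C. dist x z < \<delta> \<longrightarrow> (\<forall>k. dist ((f ^^ k) x) z < \<epsilon>)"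
  proof (intro exI[of _ "\<epsilon> / M'"] conjI ballI impI allI)
    show "\<epsilon> / M' > 0" using \<open>\<epsilon> > 0\<close> M'(1) by simp
    fix x k assume "x \<in> C" and x: "dist x z < \<epsilon> / M'"
    have "dist ((f ^^ k) x) z \<le> b k * dist x z" by (rule bound[OF \<open>x \<in> C\<close>])
    also have "\<dots> \<le> M' * dist x z" using M'(2) by (intro mult_right_mono) auto
    also have "\<dots> < \<epsilon>" using x M'(1) by (simp add: field_simps)
    finally show "dist ((f ^^ k) x) z < \<epsilon>" .
  qed
next
  fix x assume "x \<in> C"
  have "(\<lambda>k. b k * dist x z) \<longlonglongrightarrow> 0"
    using tendsto_mult_left_zero[OF b] .
  then have "(\<lambda>k. dist ((f ^^ k) x) z) \<longlonglongrightarrow> 0"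
    by (rule tendsto_sandwich[OF _ _ tendsto_const, rotated 2])
       (auto intro: always_eventually bound[OF \<open>x \<in> C\<close>])
  then show "(\<lambda>k. (f ^^ k) x) \<longlonglongrightarrow> z"
    by (rule tendsto_dist_iff[THEN iffD2])
qed

lemma eventually_contractive_fixed_point:
  fixes f :: "'a::metric_space \<Rightarrow> 'a"
  assumes "complete C" and "C \<noteq> {}" and inv: "f ` C \<subseteq> C"
    and L: "L-lipschitz_on C f"
    and "s \<ge> 1" and c: "c-lipschitz_on C (f ^^ s)" "c < 1"
  shows "\<exists>z\<in>C. f z = z \<and> (\<forall>y\<in>C. f y = y \<longrightarrow> y = z) \<and>
           globally_asymptotically_stable_in f C z"
proof -
  note in_C = funpow_in_invariant[OF inv]
  have "0 \<le> c" using c(1) by (rule lipschitz_on_nonneg)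
  have inv_s: "(f ^^ s) ` C \<subseteq> C" using in_C by blast
  have "\<exists>!z. z \<in> C \<and> (f ^^ s) z = z"
    using assms(1,2) \<open>0 \<le> c\<close> c inv_s by (intro Banach_fix) (auto dest: lipschitz_onD)
  then obtain z where z: "z \<in> C" "(f ^^ s) z = z"
    and unique: "\<And>y. y \<in> C \<Longrightarrow> (f ^^ s) y = y \<Longrightarrow> y = z"
    by blast
  have "f z = z"
  proof (rule unique)
    show "f z \<in> C" using inv z(1) by blast
    show "(f ^^ s) (f z) = f z" using z(2) by (metis funpow_swap1)
  qed
  have fixed: "(f ^^ k) y = y" if "f y = y" for k y
    using that by (induction k) auto
  \<comment> \<open>With base \<open>max 1 L\<close> powers increase in the exponent, so
    \<open>M\<close> dominates the constants of all remainders \<open>k mod s < s\<close>; for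
    \<open>L < 1\<close> the power \<open>L ^ s\<close> would not.\<close>
  define M where "M = max 1 L ^ s"
  define b where "b k = M * c ^ (k div s)" for k
  have lip: "(max 1 L)-lipschitz_on C f"
    using L by (rule lipschitz_on_mono) auto
  have "M \<ge> 0" by (simp add: M_def)
  have "dist ((f ^^ k) x) z \<le> b k * dist x z" if "x \<in> C" for x k
  proof -
    define y where "y = ((f ^^ s) ^^ (k div s)) x"
    have "y \<in> C" unfolding y_def using in_C that by (simp add: funpow_mult)
    have "f ^^ k = (f ^^ (k mod s)) \<circ> ((f ^^ s) ^^ (k div s))"
      by (metis funpow_add funpow_mult mod_mult_div_eq)
    then have "dist ((f ^^ k) x) z = dist ((f ^^ (k mod s)) y) ((f ^^ (k mod s)) z)"
      by (simp add: y_def fixed[OF \<open>f z = z\<close>])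
    also have "\<dots> \<le> max 1 L ^ (k mod s) * dist y z"
      using lipschitz_onD[OF lipschitz_on_funpow[OF inv lip] \<open>y \<in> C\<close> z(1)] .
    also have "\<dots> \<le> M * dist y z"
      unfolding M_def using \<open>s \<ge> 1\<close>
      by (intro mult_right_mono power_increasing) (auto intro: less_imp_le)
    \<comment> \<open>Writing \<open>z\<close> as its own iterate lets the contraction estimate
      apply to the pair \<open>x\<close>, \<open>z\<close>.\<close>
    also have "dist y z = dist y (((f ^^ s) ^^ (k div s)) z)"
      by (simp add: funpow_mult fixed[OF \<open>f z = z\<close>])
    also have "\<dots> \<le> c ^ (k div s) * dist x z"
      unfolding y_def using lipschitz_onD[OF lipschitz_on_funpow[OF inv_s c(1)] that z(1)] .
    finally show ?thesis using \<open>M \<ge> 0\<close> by (simp add: b_def mult_left_mono mult.assoc)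
  qed
  moreover have "b \<longlonglongrightarrow> 0"
  proof -
    have "filterlim (\<lambda>k. k div s) at_top sequentially"
      using \<open>s \<ge> 1\<close> by (intro filterlim_at_top_div_const_nat) simp
    moreover have "(\<lambda>n. c ^ n) \<longlonglongrightarrow> 0"
      using \<open>0 \<le> c\<close> c(2) by (intro LIMSEQ_power_zero) simp
    ultimately have "(\<lambda>k. c ^ (k div s)) \<longlonglongrightarrow> 0" by (rule filterlim_compose[rotated])
    then show ?thesis unfolding b_def by (rule tendsto_mult_right_zero)
  qed
  moreover have "b k \<le> M" for k
    using \<open>M \<ge> 0\<close> \<open>0 \<le> c\<close> c(2) by (simp add: b_def mult_left_le power_le_one)
  ultimately have "globally_asymptotically_stable_in f C z"
    by (rule globally_asymptotically_stable_inI)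
  \<comment> \<open>A fixed point of \<open>f\<close> is also fixed by \<open>f ^^ s\<close>, so
    \<open>unique\<close> settles uniqueness for \<open>f\<close>.\<close>
  with z(1) \<open>f z = z\<close> unique fixed show ?thesis by blast
qed

theorem proposition3:
  fixes f :: "real ^ 'm \<Rightarrow> real ^ 'm"
    and C :: "(real ^ 'm) set"
  assumes "\<exists>L. L-lipschitz_on UNIV f"
    and "continuously_differentiable f"
    and "C \<noteq> {}" and "convex C" and "compact C"
    and "f ` C \<subseteq> C"
    and "\<exists>p\<ge>1. \<exists>N :: real ^ 'm \<Rightarrow> real. is_norm N \<and> sup_mean_contractive N C (f ^^ p)"
  shows "\<exists>z\<in>C. f z = z \<and> (\<forall>y\<in>C. f y = y \<longrightarrow> y = z) \<and>
           globally_asymptotically_stable_in f C z"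
proof -
  obtain L where L: "L-lipschitz_on C f"
    using assms(1) lipschitz_on_subset[OF _ subset_UNIV] by metis
  obtain p N where p: "p \<ge> 1" and N: "is_norm N" "sup_mean_contractive N C (f ^^ p)"
    using assms(7) by blast
  have "(f ^^ p) ` C \<subseteq> C" using funpow_in_invariant[OF assms(6)] by blast
  \<comment> \<open>Iterating \<open>f ^^ p\<close> a further \<open>n\<close> times yields the
    contracting power, with \<open>s = p * n\<close>.\<close>
  from eventual_contraction[OF N this] obtain n where
    n: "n \<ge> 1" "(1/2)-lipschitz_on C (f ^^ (p * n))"
    by (auto simp: funpow_mult)
  have "p * n \<ge> 1" using p n(1) by (simp add: Suc_le_eq)
  from eventually_contractive_fixed_point[OF compact_imp_complete[OF assms(5)] assms(3,6) L this n(2)]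
  show ?thesis by simp
qed

end
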